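(* Let $0\le\alpha<1$ and let $p(\cdot)\in\mathcal S$ with $p_+<\infty$, $p_->1$ and $1<p_-\le p_+<\frac1\alpha$ (where $\frac1\alpha=\infty$ if $\alpha=0$). Define the exponent sequence $q(\cdot)$ by $$\frac1{p(k)}-\frac1{q(k)}=\alpha,\qquad k\in\mathbb Z,$$ and assume $p(\cdot)\in LH_\infty(\mathbb Z)$ and $q(\cdot)\in LH_\infty(\mathbb Z)$. Then there is a constant $C>0$, not depending on $a$, such that for every non-negative sequence $a=\{a(i)\}_{i\in\mathbb Z}\in\ell^{p(\cdot)}(\mathbb Z)$, $$\|M_\alpha a\|_{\ell^{q(\cdot)}(\mathbb Z)}\le C\,\|a\|_{\ell^{p(\cdot)}(\mathbb Z)}.$$
   Context: $\mathcal S$ is the set of bounded sequences $p(\cdot)=\{p(n)\}_{n\in\mathbb Z}$ with values in $[1,\infty)$; $p_-=\inf_n p(n)$ and $p_+=\sup_n p(n)<\infty$. For $p(\cdot)\in\mathcal S$ the modular is $\rho_{p(\cdot)}(a)=\sum_{k\in\mathbb Z}|a(k)|^{p(k)}$; $\ell^{p(\cdot)}(\mathbb Z)$ is the set of real sequences $a$ on $\mathbb Z$ such that $\rho_{p(\cdot)}(a/\lambda)<\infty$ for some $\lambda>0$, with norm $\|a\|_{\ell^{p(\cdot)}(\mathbb Z)}=\inf\{\lambda>0:\rho_{p(\cdot)}(a/\lambda)\le1\}$. A sequence $p(\cdot)$ is log-Hölder continuous at infinity, written $p(\cdot)\in LH_\infty(\mathbb Z)$, if there are positive real constants $C_\infty,p_\infty$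 such that $|p(n)-p_\infty|\le \frac{C_\infty}{\log(e+|n|)}$ for all $n\in\mathbb Z$. For $0\le\alpha<1$ the fractional Hardy–Littlewood maximal operator is $M_\alpha a(n)=\sup_{I\ni n}|I|^{\alpha-1}\sum_{k\in I}|a(k)|$, where the supremum is over all (finite) intervals $I$ of integers containing $n$ and $|I|$ is the cardinality of $I$. *)

theory Defs
  imports "HOL-Analysis.Analysis"
begin

definition exponent_seqs :: "(int \<Rightarrow> real) set" where
  "exponent_seqs = {p. bounded (range p) \<and> (\<forall>n. 1 \<le> p n)}"

definition exp_minus :: "(int \<Rightarrow> real) \<Rightarrow> real" where
  "exp_minus p = (INF n. p n)"

definition exp_plus :: "(int \<Rightarrow> real) \<Rightarrow> real" where
  "exp_plus p = (SUP n. p n)"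

definition modular :: "(int \<Rightarrow> real) \<Rightarrow> (int \<Rightarrow> real) \<Rightarrow> ennreal" where
  "modular p a = (\<Sum>\<^sub>\<infinity>k\<in>UNIV. ennreal (\<bar>a k\<bar> powr p k))"

definition lpvar :: "(int \<Rightarrow> real) \<Rightarrow> (int \<Rightarrow> real) set" where
  "lpvar p = {a. \<exists>l>0. modular p (\<lambda>k. a k / l) < \<infinity>}"

(* The infimum is real-valued, so this is the norm only for a \<in> lpvar p; elsewhere the set
   is empty and the value is arbitrary. *)
definition lpvar_norm :: "(int \<Rightarrow> real) \<Rightarrow> (int \<Rightarrow> real) \<Rightarrow> real" where
  "lpvar_norm p a = Inf {l. 0 < l \<and> modular p (\<lambda>k. a k / l) \<le> 1}"

definition LH_inf :: "(int \<Rightarrow> real) set" where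
  "LH_inf = {p. \<exists>C>0. \<exists>p_inf>0. \<forall>n. \<bar>p n - p_inf\<bar> \<le> C / ln (exp 1 + \<bar>real_of_int n\<bar>)}"

(* Extended-valued, since the supremum is infinite for some sequences. *)
definition frac_maximal :: "real \<Rightarrow> (int \<Rightarrow> real) \<Rightarrow> int \<Rightarrow> ennreal" where
  "frac_maximal \<alpha> a n =
     (SUP I \<in> {I. n \<in> I \<and> (\<exists>i j. I = {i..j})}.
        ennreal (real (card I) powr (\<alpha> - 1) * (\<Sum>k\<in>I. \<bar>a k\<bar>)))"

end

theory Submission
  imports Defs
begin

text \<open>
  Sequences in the unit ball of a variable exponent space are bounded by 1, so log-Hoelder decay
  at infinity makes the variable exponents interchangeable with their limits: for
  \<open>0 \<le> x \<le> 1\<close> and \<open>\<bar>s - t\<bar> \<le> C / ln y\<close> one has \<open>x powr s \<le> exp (2 * C) * x powr t + 1 / y\<^sup>2\<close>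
  (distinguish \<open>x < 1 / y\<^sup>2\<close>), and with \<open>y = exp 1 + \<bar>n\<bar>\<close> the error terms are summable over the
  integers. For constant exponents, Hedberg's inequality reduces the fractional maximal operator to
  the usual one. The latter is at most the sum of its left- and right-sided versions, for which
  Garsia's argument gives \<open>t * card {m > t} \<le> sum x {m > t}\<close>; integrating this against
  \<open>t powr (p - 2)\<close> yields the strong type bound. Suprema over intervals are replaced by one
  arbitrary interval around each point, the bounds being uniform in that choice.
\<close>

section \<open>One-sided maximal functions on the naturals and their weak type bound\<close>

text \<open>Kadane's recursion: the value at \<open>Suc k\<close> is the larger of 0 and the best
  sum of \<open>b\<close> over a block \<open>{i..k}\<close>.\<close>

primrec running_excess :: "(nat \<Rightarrow> real) \<Rightarrow> nat \<Rightarrow> real" where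
  "running_excess b 0 = 0"
| "running_excess b (Suc k) = max 0 (b k + running_excess b k)"

lemma running_excess_nonneg: "0 \<le> running_excess b k"
  by (cases k) auto

lemma sum_le_running_excess:
  "i \<le> k \<Longrightarrow> sum b {i..k} \<le> running_excess b (Suc k)"
proof (induction k)
  case 0
  then show ?case by simp
next
  case (Suc k)
  show ?case
  proof (cases "i = Suc k")
    case True
    then show ?thesis using running_excess_nonneg[of b "Suc k"] by simp
  next
    case False
    then have "i \<le> k" using Suc.prems by simp
    then show ?thesis using Suc.IH by (simp add: Suc.prems)
  qed
qed

text \<open>A positive value does not come from the cutoff at 0: either the best block ending one
  step earlier is extended, or that earlier excess is 0 and a new block starts.\<close>

lemma running_excess_attained:
  "0 < running_excess b (Suc k) \<Longrightarrow> \<exists>i\<le>k. sum b {i..k} = running_excess b (Suc k)"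
proof (induction k)
  case 0
  then show ?case by auto
next
  case (Suc k)
  then have eq: "running_excess b (Suc (Suc k)) = b (Suc k) + running_excess b (Suc k)"
    by (simp split: if_splits)
  show ?case
  proof (cases "0 < running_excess b (Suc k)")
    case True
    then obtain i where i: "i \<le> k" "sum b {i..k} = running_excess b (Suc k)"
      using Suc.IH by blast
    have "sum b {i..Suc k} = running_excess b (Suc (Suc k))"
      unfolding eq i(2)[symmetric] using i(1) by simp
    then show ?thesis using i(1) le_SucI by blast
  next
    case False
    then have "sum b {Suc k..Suc k} = running_excess b (Suc (Suc k))"
      unfolding eq using running_excess_nonneg[of b "Suc k"] by simp
    then show ?thesis by blast
  qed
qed

text \<open>Garsia's argument. A step to a positive excess adds exactly \<open>b N\<close>; a step
  to excess 0 cannot increase it and contributes 0 on the right.\<close>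

lemma running_excess_le_sum:
  "running_excess b N \<le> (\<Sum>k<N. if 0 < running_excess b (Suc k) then b k else 0)"
proof (induction N)
  case 0
  then show ?case by simp
next
  case (Suc N)
  then show ?case
    using running_excess_nonneg[of b N]
    by (simp del: running_excess.simps) (auto simp: max_def)
qed

definition left_maximal :: "(nat \<Rightarrow> real) \<Rightarrow> nat \<Rightarrow> real" where
  "left_maximal x k = Max ((\<lambda>i. sum x {i..k} / real (Suc k - i)) ` {..k})"

lemma mean_le_left_maximal:
  "i \<le> k \<Longrightarrow> sum x {i..k} / real (Suc k - i) \<le> left_maximal x k"
  unfolding left_maximal_def by (intro Max_ge) auto

text \<open>A mean exceeds \<open>t\<close> exactly when \<open>x j - t\<close> has positive sum
  over its block, so level sets of the maximal function are positivity sets of a running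
  excess.\<close>

lemma less_left_maximal_iff:
  "t < left_maximal x k \<longleftrightarrow> 0 < running_excess (\<lambda>j. x j - t) (Suc k)"
proof -
  have "t < left_maximal x k \<longleftrightarrow> (\<exists>i\<le>k. t < sum x {i..k} / real (Suc k - i))"
    unfolding left_maximal_def by (subst Max_gr_iff) auto
  also have "\<dots> \<longleftrightarrow> (\<exists>i\<le>k. 0 < (\<Sum>j=i..k. x j - t))"
    by (auto simp: sum_subtractf field_simps of_nat_diff)
  also have "\<dots> \<longleftrightarrow> 0 < running_excess (\<lambda>j. x j - t) (Suc k)"
    using sum_le_running_excess[of _ k "\<lambda>j. x j - t"] running_excess_attained[of "\<lambda>j. x j - t" k]
    by (metis order_less_le_trans)
  finally show ?thesis .
qed

text \<open>Weak type bound in subtracted form: \<open>t\<close> times the size of the level set is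
  at most the sum of \<open>x\<close> over it.\<close>

lemma left_maximal_weak_type:
  "0 \<le> (\<Sum>k<N. if t < left_maximal x k then x k - t else 0)"
  unfolding less_left_maximal_iff
  using order_trans[OF running_excess_nonneg running_excess_le_sum] .

section \<open>From weak type to strong type\<close>

text \<open>The contribution of one index when the weak type inequality is integrated against
  \<open>t powr (p - 2)\<close>; this weight is integrable at 0 because
  \<open>p > 1\<close>.\<close>

lemma has_integral_truncated_level:
  fixes m x p :: real
  assumes "0 \<le> m" "1 < p"
  shows "((\<lambda>t. if t \<in> {0<..<m} then t powr (p - 2) * (x - t) else 0) has_integral
           (x * m powr (p - 1) / (p - 1) - m powr p / p)) UNIV"
proof -
  have "((\<lambda>t. t powr (p - 2) * x - t powr (p - 1)) has_integral
           (m powr (p - 1) / (p - 1) * x - m powr p / p)) {0..m}"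
    using has_integral_powr_from_0[of "p - 2" m] has_integral_powr_from_0[of "p - 1" m] assms
    by (intro has_integral_diff has_integral_mult_left) auto
  then have "((\<lambda>t. t powr (p - 2) * x - t powr (p - 1)) has_integral
           (m powr (p - 1) / (p - 1) * x - m powr p / p)) {0<..<m}"
    by (simp add: has_integral_Icc_iff_Ioo)
  then have "((\<lambda>t. t powr (p - 2) * (x - t)) has_integral
           (x * m powr (p - 1) / (p - 1) - m powr p / p)) {0<..<m}"
  proof (subst has_integral_cong)
    fix t assume "t \<in> {0<..<m}"
    then have "t powr (p - 1) = t powr (p - 2) * t"
      by (simp add: powr_mult_base mult.commute)
    then show "t powr (p - 2) * (x - t) = t powr (p - 2) * x - t powr (p - 1)"
      by (simp add: algebra_simps)
  qed (simp add: mult.commute)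
  then show ?thesis
    by (subst has_integral_restrict_UNIV)
qed

text \<open>Integration over the levels \<open>t\<close> bounds the sum of \<open>m k powr p\<close>
  by \<open>c\<close> times that of \<open>x k * m k powr (p - 1)\<close>. A pointwise splitting
  then takes the place of Hoelder's inequality, at the price of a factor 2 inside the
  constant.\<close>

lemma strong_type_from_weak_type:
  fixes m x :: "'a \<Rightarrow> real" and p :: real
  assumes "finite X" "1 < p"
    and m: "\<And>k. k \<in> X \<Longrightarrow> 0 \<le> m k" and x: "\<And>k. k \<in> X \<Longrightarrow> 0 \<le> x k"
    and weak: "\<And>t. 0 < t \<Longrightarrow> 0 \<le> (\<Sum>k\<in>X. if t < m k then x k - t else 0)"
  shows "(\<Sum>k\<in>X. m k powr p) \<le> (2 * p / (p - 1)) powr p * (\<Sum>k\<in>X. x k powr p)"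
proof -
  define c where "c = p / (p - 1)"
  have c: "0 < c" using assms(2) by (simp add: c_def)
  let ?f = "\<lambda>t. \<Sum>k\<in>X. if t \<in> {0<..<m k} then t powr (p - 2) * (x k - t) else 0"
  have "(?f has_integral (\<Sum>k\<in>X. x k * m k powr (p - 1) / (p - 1) - m k powr p / p)) UNIV"
    by (intro has_integral_sum has_integral_truncated_level assms)
  moreover have "0 \<le> ?f t" for t
  proof (cases "0 < t")
    case True
    then have "?f t = t powr (p - 2) * (\<Sum>k\<in>X. if t < m k then x k - t else 0)"
      unfolding sum_distrib_left by (intro sum.cong) auto
    then show ?thesis using weak[OF True] by simp
  qed simp
  ultimately have "0 \<le> (\<Sum>k\<in>X. x k * m k powr (p - 1) / (p - 1) - m k powr p / p)"
    by (rule has_integral_nonneg)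
  then have "0 \<le> p * (\<Sum>k\<in>X. x k * m k powr (p - 1) / (p - 1) - m k powr p / p)"
    using assms(2) by simp
  also have "\<dots> = (\<Sum>k\<in>X. c * (x k * m k powr (p - 1)) - m k powr p)"
    unfolding sum_distrib_left using assms(2) by (intro sum.cong) (auto simp: c_def field_simps)
  finally have *: "(\<Sum>k\<in>X. m k powr p) \<le> (\<Sum>k\<in>X. c * (x k * m k powr (p - 1)))"
    by (simp add: sum_subtractf)
  \<comment> \<open>If \<open>m k\<close> is at most \<open>2 * c * x k\<close>, replace it by that
    bound; otherwise \<open>c * x k\<close> is below \<open>m k / 2\<close>. The term
    \<open>m k powr p / 2\<close> is later absorbed into the left-hand side, a finite sum.\<close>
  have absorb: "c * (x k * m k powr (p - 1)) \<le> m k powr p / 2 + (2 * c) powr p / 2 * x k powr p"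
    if k: "k \<in> X" for k
  proof (cases "m k \<le> 2 * c * x k")
    case True
    have "c * (x k * m k powr (p - 1)) \<le> c * (x k * (2 * c * x k) powr (p - 1))"
      using True m[OF k] x[OF k] c assms(2) by (intro mult_left_mono powr_mono2) auto
    also have "\<dots> = (2 * c * x k) powr p / 2"
      using powr_mult_base[of "2 * c * x k" "p - 1"] x[OF k] c by simp
    also have "\<dots> = (2 * c) powr p / 2 * x k powr p"
      using x[OF k] c by (simp add: powr_mult)
    finally show ?thesis by (smt (verit) powr_ge_zero divide_nonneg_nonneg)
  next
    case False
    then have "c * x k * m k powr (p - 1) \<le> m k / 2 * m k powr (p - 1)"
      by (intro mult_right_mono) auto
    also have "\<dots> = m k powr p / 2"
      using powr_mult_base[of "m k" "p - 1"] m[OF k] by simp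
    finally show ?thesis by (simp add: mult.assoc add_increasing2)
  qed
  have "(\<Sum>k\<in>X. m k powr p) \<le> (\<Sum>k\<in>X. m k powr p / 2 + (2 * c) powr p / 2 * x k powr p)"
    by (rule order_trans[OF * sum_mono[OF absorb]])
  also have "\<dots> = (\<Sum>k\<in>X. m k powr p) / 2 + (2 * c) powr p / 2 * (\<Sum>k\<in>X. x k powr p)"
    by (simp add: sum.distrib sum_distrib_left sum_divide_distrib)
  finally show ?thesis by (simp add: c_def)
qed

section \<open>Strong type bounds for means over chosen intervals of integers\<close>

lemma left_means_strong_type:
  fixes x :: "nat \<Rightarrow> real" and i :: "nat \<Rightarrow> nat" and p :: real
  assumes "1 < p" and x: "\<And>k. 0 \<le> x k" and i: "\<And>k. k \<in> W \<Longrightarrow> i k \<le> k" and W: "W \<subseteq> {..<N}"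
  shows "(\<Sum>k\<in>W. (sum x {i k..k} / real (Suc k - i k)) powr p)
           \<le> (2 * p / (p - 1)) powr p * (\<Sum>k<N. x k powr p)"
proof -
  have m: "0 \<le> left_maximal x k" for k
    by (rule order_trans[OF _ mean_le_left_maximal[of 0]])
      (auto intro!: sum_nonneg x divide_nonneg_nonneg)
  have "(\<Sum>k\<in>W. (sum x {i k..k} / real (Suc k - i k)) powr p) \<le> (\<Sum>k\<in>W. left_maximal x k powr p)"
    using assms by (intro sum_mono powr_mono2 mean_le_left_maximal) (auto intro!: sum_nonneg divide_nonneg_nonneg)
  also have "\<dots> \<le> (\<Sum>k<N. left_maximal x k powr p)"
    using W by (intro sum_mono2) auto
  also have "\<dots> \<le> (2 * p / (p - 1)) powr p * (\<Sum>k<N. x k powr p)"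
    using assms m left_maximal_weak_type by (intro strong_type_from_weak_type) auto
  finally show ?thesis .
qed

text \<open>Translation by \<open>l\<close>, which lies below all the chosen left endpoints, carries
  the situation to the naturals.\<close>

lemma left_means_strong_type_int:
  fixes a :: "int \<Rightarrow> real" and i :: "int \<Rightarrow> int" and p :: real
  assumes "1 < p" and a: "\<And>k. 0 \<le> a k"
    and W: "\<And>n. n \<in> W \<Longrightarrow> l \<le> i n \<and> i n \<le> n \<and> n \<le> h"
  shows "(\<Sum>n\<in>W. (sum a {i n..n} / real (card {i n..n})) powr p)
           \<le> (2 * p / (p - 1)) powr p * (\<Sum>k\<in>{l..h}. a k powr p)"
proof -
  let ?x = "\<lambda>k. a (l + int k)" and ?i = "\<lambda>k. nat (i (l + int k) - l)"
  let ?W = "(\<lambda>n. nat (n - l)) ` W" and ?N = "nat (h - l + 1)"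
  have mean: "sum ?x {?i k..k} / real (Suc k - ?i k) = sum a {i n..n} / real (card {i n..n})"
    if "n \<in> W" "k = nat (n - l)" for n k
  proof -
    have "sum ?x {?i k..k} = sum a {i n..n}"
      using W[OF that(1)] that(2)
      by (intro sum.reindex_bij_witness[of _ "\<lambda>n. nat (n - l)" "\<lambda>k. l + int k"]) auto
    moreover have "Suc k - ?i k = card {i n..n}"
      using W[OF that(1)] that(2) by auto
    ultimately show ?thesis by simp
  qed
  have inj: "inj_on (\<lambda>n. nat (n - l)) W"
  proof (rule inj_onI)
    fix m n assume "m \<in> W" "n \<in> W" "nat (m - l) = nat (n - l)"
    then show "m = n" using W[of m] W[of n] by linarith
  qed
  have "(\<Sum>n\<in>W. (sum a {i n..n} / real (card {i n..n})) powr p)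
      = (\<Sum>k\<in>?W. (sum ?x {?i k..k} / real (Suc k - ?i k)) powr p)"
    unfolding sum.reindex[OF inj] comp_def by (intro sum.cong refl) (simp only: mean[OF _ refl])
  also have "\<dots> \<le> (2 * p / (p - 1)) powr p * (\<Sum>k<?N. ?x k powr p)"
  proof (rule left_means_strong_type[OF \<open>1 < p\<close> a])
    show "?i k \<le> k" if k: "k \<in> ?W" for k
    proof -
      obtain n where "n \<in> W" and n: "k = nat (n - l)" using k by blast
      show ?thesis using W[OF \<open>n \<in> W\<close>] unfolding n by (simp add: nat_mono)
    qed
    show "?W \<subseteq> {..<?N}"
    proof (rule image_subsetI)
      fix n assume "n \<in> W"
      show "nat (n - l) \<in> {..<?N}" using W[OF \<open>n \<in> W\<close>] by simp
    qed
  qed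
  also have "(\<Sum>k<?N. ?x k powr p) = (\<Sum>k\<in>{l..h}. a k powr p)"
    by (rule sum.reindex_bij_witness[of _ "\<lambda>n. nat (n - l)" "\<lambda>k. l + int k"]) auto
  finally show ?thesis .
qed

text \<open>The reflection \<open>k\<close> to \<open>-k\<close> exchanges left-sided and
  right-sided means.\<close>

lemma right_means_strong_type_int:
  fixes a :: "int \<Rightarrow> real" and j :: "int \<Rightarrow> int" and p :: real
  assumes "1 < p" and a: "\<And>k. 0 \<le> a k"
    and W: "\<And>n. n \<in> W \<Longrightarrow> l \<le> n \<and> n \<le> j n \<and> j n \<le> h"
  shows "(\<Sum>n\<in>W. (sum a {n..j n} / real (card {n..j n})) powr p)
           \<le> (2 * p / (p - 1)) powr p * (\<Sum>k\<in>{l..h}. a k powr p)"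
proof -
  have reflect: "(\<Sum>k\<in>{u..v}. f (- k)) = sum f {-v..-u}" for f :: "int \<Rightarrow> real" and u v
    by (rule sum.reindex_bij_witness[of _ uminus uminus]) auto
  have "(\<Sum>n\<in>W. (sum a {n..j n} / real (card {n..j n})) powr p)
      = (\<Sum>n\<in>uminus ` W. ((\<Sum>k\<in>{- j (- n)..n}. a (- k)) / real (card {- j (- n)..n})) powr p)"
    by (subst sum.reindex) (auto intro!: sum.cong simp: reflect)
  also have "\<dots> \<le> (2 * p / (p - 1)) powr p * (\<Sum>k\<in>{-h..-l}. a (- k) powr p)"
    using assms by (intro left_means_strong_type_int) auto
  also have "(\<Sum>k\<in>{-h..-l}. a (- k) powr p) = (\<Sum>k\<in>{l..h}. a k powr p)"
    using reflect[where f = "\<lambda>k. a k powr p" and u = "-h" and v = "-l"] by simp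
  finally show ?thesis .
qed

text \<open>The two halves cover the interval, and each has no more points than the whole, so
  dividing by its own cardinality only enlarges its term.\<close>

lemma mean_le_left_plus_right:
  fixes a :: "int \<Rightarrow> real"
  assumes "i \<le> n" "n \<le> j" and a: "\<And>k. 0 \<le> a k"
  shows "sum a {i..j} / real (card {i..j})
           \<le> sum a {i..n} / real (card {i..n}) + sum a {n..j} / real (card {n..j})"
proof -
  have "sum a {i..j} \<le> sum a ({i..n} \<union> {n..j})"
    using a by (intro sum_mono2) auto
  also have "\<dots> \<le> sum a {i..n} + sum a {n..j}"
    using a by (subst sum_Un) (auto intro: sum_nonneg)
  finally have "sum a {i..j} / real (card {i..j})
      \<le> sum a {i..n} / real (card {i..j}) + sum a {n..j} / real (card {i..j})"
    by (simp add: divide_right_mono flip: add_divide_distrib)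
  also have "\<dots> \<le> sum a {i..n} / real (card {i..n}) + sum a {n..j} / real (card {n..j})"
    using assms by (intro add_mono divide_left_mono sum_nonneg) auto
  finally show ?thesis .
qed

lemma powr_add_le:
  fixes u v p :: real
  assumes "0 \<le> u" "0 \<le> v" "0 \<le> p"
  shows "(u + v) powr p \<le> 2 powr p * (u powr p + v powr p)"
proof -
  have "(u + v) powr p \<le> (2 * max u v) powr p"
    using assms by (intro powr_mono2) auto
  also have "\<dots> = 2 powr p * max u v powr p"
    using assms by (simp add: powr_mult)
  also have "\<dots> \<le> 2 powr p * (u powr p + v powr p)"
    by (intro mult_left_mono) (auto simp: max_def)
  finally show ?thesis .
qed

text \<open>The outer \<open>2 powr p\<close> pays for splitting a mean into two one-sided means,
  the inner 2 counts the sides.\<close>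

definition maximal_const :: "real \<Rightarrow> real" where
  "maximal_const p = 2 powr p * (2 * (2 * p / (p - 1)) powr p)"

lemma maximal_const_nonneg: "0 \<le> maximal_const p"
  by (simp add: maximal_const_def)

text \<open>\<open>A\<close> bounds all finite partial sums and so stands for the sum over all
  integers; the result depends neither on \<open>W\<close> nor on the chosen endpoints.\<close>

lemma means_strong_type:
  fixes a :: "int \<Rightarrow> real" and i j :: "int \<Rightarrow> int" and p :: real
  assumes "1 < p" and a: "\<And>k. 0 \<le> a k"
    and bound: "\<And>F. finite F \<Longrightarrow> (\<Sum>k\<in>F. a k powr p) \<le> A"
    and "finite W" and W: "\<And>n. n \<in> W \<Longrightarrow> i n \<le> n \<and> n \<le> j n"
  shows "(\<Sum>n\<in>W. (sum a {i n..j n} / real (card {i n..j n})) powr p) \<le> maximal_const p * A"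
proof -
  \<comment> \<open>A window containing all chosen intervals; the inserted 0 keeps
    \<open>Min\<close> and \<open>Max\<close> meaningful for empty \<open>W\<close>.\<close>
  define l where "l = Min (insert 0 (i ` W))"
  define h where "h = Max (insert 0 (j ` W))"
  let ?u = "\<lambda>n. sum a {i n..n} / real (card {i n..n})"
  let ?v = "\<lambda>n. sum a {n..j n} / real (card {n..j n})"
  let ?K = "(2 * p / (p - 1)) powr p"
  have lh: "l \<le> i n" "j n \<le> h" if "n \<in> W" for n
    using that \<open>finite W\<close> by (auto simp: l_def h_def)
  have nonneg: "0 \<le> sum a {u..v} / real (card {u..v})" for u v
    by (simp add: sum_nonneg a)
  have "(sum a {i n..j n} / real (card {i n..j n})) powr p \<le> 2 powr p * (?u n powr p + ?v n powr p)"
    if "n \<in> W" for n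
  proof -
    have "(sum a {i n..j n} / real (card {i n..j n})) powr p \<le> (?u n + ?v n) powr p"
      using \<open>1 < p\<close> W[OF that] a nonneg[of "i n" "j n"]
      by (intro powr_mono2 mean_le_left_plus_right) simp_all
    also have "\<dots> \<le> 2 powr p * (?u n powr p + ?v n powr p)"
      using \<open>1 < p\<close> nonneg by (intro powr_add_le) auto
    finally show ?thesis .
  qed
  then have "(\<Sum>n\<in>W. (sum a {i n..j n} / real (card {i n..j n})) powr p)
      \<le> 2 powr p * ((\<Sum>n\<in>W. ?u n powr p) + (\<Sum>n\<in>W. ?v n powr p))"
    unfolding sum.distrib[symmetric] sum_distrib_left by (intro sum_mono)
  also have "\<dots> \<le> 2 powr p * (?K * (\<Sum>k\<in>{l..h}. a k powr p) + ?K * (\<Sum>k\<in>{l..h}. a k powr p))"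
    using lh W \<open>1 < p\<close> a
    by (intro mult_left_mono add_mono left_means_strong_type_int right_means_strong_type_int)
      (auto intro: order_trans)
  also have "\<dots> = maximal_const p * (\<Sum>k\<in>{l..h}. a k powr p)"
    by (simp add: maximal_const_def)
  also have "\<dots> \<le> maximal_const p * A"
    by (intro mult_left_mono bound maximal_const_nonneg) auto
  finally show ?thesis .
qed

section \<open>Fractional means with constant exponents\<close>

text \<open>The first factor comes from Hedberg's inequality, the second from the strong type
  bound.\<close>

definition frac_const :: "real \<Rightarrow> real \<Rightarrow> real \<Rightarrow> real \<Rightarrow> real" where
  "frac_const \<alpha> p q A = (maximal_const p * A) powr (\<alpha> * q) * (maximal_const p * A)"

text \<open>Here \<open>c\<close> is the length of an interval and \<open>m\<close> the mean over
  it. As \<open>q = p * (\<alpha> * q) + p\<close>, part of the power of \<open>m\<close> combines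
  with \<open>c powr (\<alpha> * q)\<close> into a power of \<open>c * m powr p\<close>.\<close>

lemma hedberg:
  fixes c m D p q \<alpha> :: real
  assumes "0 < c" "0 \<le> m" "0 < p" "0 < q" "0 \<le> \<alpha>" and pq: "1 / p - 1 / q = \<alpha>"
    and bound: "c * m powr p \<le> D"
  shows "(c powr \<alpha> * m) powr q \<le> D powr (\<alpha> * q) * m powr p"
proof -
  have exps: "q = p * (\<alpha> * q) + p"
    unfolding pq[symmetric] using assms(3,4) by (simp add: field_simps)
  have "(c powr \<alpha> * m) powr q = c powr (\<alpha> * q) * m powr q"
    using assms(1,2) by (simp add: powr_mult powr_powr)
  also have "m powr q = m powr (p * (\<alpha> * q)) * m powr p"
    by (subst (1) exps) (rule powr_add)
  also have "c powr (\<alpha> * q) * \<dots> = (c * m powr p) powr (\<alpha> * q) * m powr p"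
    using assms(1,2) by (simp add: powr_mult powr_powr)
  also have "\<dots> \<le> D powr (\<alpha> * q) * m powr p"
    using assms by (intro mult_right_mono powr_mono2) auto
  finally show ?thesis .
qed

lemma frac_means_strong_type:
  fixes a :: "int \<Rightarrow> real" and i j :: "int \<Rightarrow> int" and p q \<alpha> :: real
  assumes "1 < p" "0 < q" "0 \<le> \<alpha>" and pq: "1 / p - 1 / q = \<alpha>"
    and a: "\<And>k. 0 \<le> a k"
    and bound: "\<And>F. finite F \<Longrightarrow> (\<Sum>k\<in>F. a k powr p) \<le> A"
    and "finite W" and W: "\<And>n. n \<in> W \<Longrightarrow> i n \<le> n \<and> n \<le> j n"
  shows "(\<Sum>n\<in>W. (real (card {i n..j n}) powr (\<alpha> - 1) * sum a {i n..j n}) powr q) \<le> frac_const \<alpha> p q A"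
proof -
  let ?c = "\<lambda>n. real (card {i n..j n})"
  let ?m = "\<lambda>n. sum a {i n..j n} / ?c n"
  let ?D = "maximal_const p * A"
  have m: "0 \<le> ?m n" for n by (simp add: sum_nonneg a)
  have "(?c n powr (\<alpha> - 1) * sum a {i n..j n}) powr q \<le> ?D powr (\<alpha> * q) * ?m n powr p" if n: "n \<in> W" for n
  proof -
    have c: "0 < ?c n" using W[OF n] by simp
    have "?c n * ?m n powr p = (\<Sum>k\<in>{i n..j n}. ?m n powr p)"
      using c by simp
    also have "\<dots> \<le> ?D" \<comment> \<open>the maximal inequality with the same interval at each of its points\<close>
      by (rule means_strong_type[where i = "\<lambda>_. i n" and j = "\<lambda>_. j n"])
        (use \<open>1 < p\<close> a bound in auto)
    finally have mean_bound: "?c n * ?m n powr p \<le> ?D" .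
    have "?c n powr (\<alpha> - 1) * sum a {i n..j n} = ?c n powr \<alpha> * ?m n"
      using c by (simp only: powr_diff powr_one) simp
    then show ?thesis
      using hedberg[OF c m _ _ _ pq mean_bound] assms(1,2,3) by simp
  qed
  then have "(\<Sum>n\<in>W. (?c n powr (\<alpha> - 1) * sum a {i n..j n}) powr q)
      \<le> ?D powr (\<alpha> * q) * (\<Sum>n\<in>W. ?m n powr p)"
    unfolding sum_distrib_left by (intro sum_mono)
  also have "\<dots> \<le> frac_const \<alpha> p q A"
    unfolding frac_const_def 
    by (intro mult_left_mono means_strong_type[where a = a] assms) auto
  finally show ?thesis .
qed

section \<open>Exchanging variable exponents for their limits\<close>

text \<open>If \<open>x\<close> is at least \<open>1 / y\<^sup>2\<close>, then \<open>- ln x\<close>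
  is at most \<open>2 * ln y\<close>, so \<open>x powr (s - t)\<close> is at most
  \<open>exp (2 * C)\<close>. For smaller \<open>x\<close> the error term suffices, since
  \<open>s \<ge> 1\<close> gives \<open>x powr s \<le> x\<close>.\<close>

lemma powr_compare_exponents:
  fixes x s t C y :: real
  assumes "0 \<le> x" "x \<le> 1" "1 \<le> s" "1 < y" and st: "\<bar>s - t\<bar> \<le> C / ln y"
  shows "x powr s \<le> exp (2 * C) * x powr t + 1 / y\<^sup>2"
proof (cases "x < 1 / y\<^sup>2")
  case True
  have "x powr s \<le> x"
    using powr_mono'[of 1 s x] assms by simp
  then show ?thesis using True by (smt (verit) exp_ge_zero mult_nonneg_nonneg powr_ge_zero)
next
  case False
  have x: "0 < x" using False \<open>1 < y\<close> by (smt (verit) zero_less_divide_1_iff zero_less_power)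
  have ln_x: "ln x \<le> 0" "- (2 * ln y) \<le> ln x"
  proof -
    show "ln x \<le> 0" using x \<open>x \<le> 1\<close> by simp
    have "ln (1 / y\<^sup>2) \<le> ln x"
      using False x \<open>1 < y\<close> by (subst ln_le_cancel_iff) auto
    then show "- (2 * ln y) \<le> ln x"
      using \<open>1 < y\<close> by (simp add: ln_div ln_realpow)
  qed
  have "(s - t) * ln x \<le> \<bar>s - t\<bar> * - ln x"
    using mult_right_mono[of "t - s" "\<bar>s - t\<bar>" "- ln x"] ln_x(1) by (simp add: algebra_simps)
  also have "\<dots> \<le> \<bar>s - t\<bar> * (2 * ln y)"
    using ln_x(2) by (intro mult_left_mono) auto
  also have "\<dots> \<le> 2 * C"
    using st \<open>1 < y\<close> by (simp add: field_simps)
  finally have "x powr (s - t) \<le> exp (2 * C)"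
    using x by (simp add: powr_def)
  then have "x powr (s - t) * x powr t \<le> exp (2 * C) * x powr t"
    by (intro mult_right_mono) auto
  then have "x powr s \<le> exp (2 * C) * x powr t"
    by (simp flip: powr_add)
  then show ?thesis by (simp add: add_increasing2)
qed

text \<open>On the non-negative and on the negative integers the absolute value is injective, and
  \<open>exp 1 \<ge> 1\<close> compares each half with the Basel series.\<close>

lemma sum_inverse_squares_int_le:
  assumes "finite F"
  shows "(\<Sum>n\<in>F. 1 / (exp 1 + \<bar>real_of_int n\<bar>)\<^sup>2) \<le> pi\<^sup>2 / 3"
proof -
  let ?g = "\<lambda>n::nat. 1 / (real n + 1)\<^sup>2"
  have sums: "?g sums (pi\<^sup>2 / 6)"
    using inverse_squares_sums by (simp add: add.commute)
  have half: "(\<Sum>n\<in>G. 1 / (exp 1 + \<bar>real_of_int n\<bar>)\<^sup>2) \<le> pi\<^sup>2 / 6"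
    if G: "finite G" and inj: "inj_on (\<lambda>n. nat \<bar>n\<bar>) G" for G
  proof -
    have "(\<Sum>n\<in>G. 1 / (exp 1 + \<bar>real_of_int n\<bar>)\<^sup>2) \<le> (\<Sum>n\<in>G. ?g (nat \<bar>n\<bar>))"
    proof (rule sum_mono)
      fix n :: int
      show "1 / (exp 1 + \<bar>real_of_int n\<bar>)\<^sup>2 \<le> ?g (nat \<bar>n\<bar>)"
        using exp_ge_add_one_self[of 1]
        by (intro divide_left_mono power_mono mult_pos_pos zero_less_power) (auto simp: add_pos_nonneg)
    qed
    also have "\<dots> = sum ?g ((\<lambda>n. nat \<bar>n\<bar>) ` G)"
      by (simp add: sum.reindex[OF inj])
    also have "\<dots> \<le> suminf ?g"
      using G by (intro sum_le_suminf sums_summable[OF sums]) auto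
    finally show ?thesis using sums by (simp add: sums_iff)
  qed
  have "(\<Sum>n\<in>F. 1 / (exp 1 + \<bar>real_of_int n\<bar>)\<^sup>2) =
      (\<Sum>n\<in>F \<inter> {0..}. 1 / (exp 1 + \<bar>real_of_int n\<bar>)\<^sup>2) +
      (\<Sum>n\<in>F - {0..}. 1 / (exp 1 + \<bar>real_of_int n\<bar>)\<^sup>2)"
    using assms by (rule sum.Int_Diff)
  also have "\<dots> \<le> pi\<^sup>2 / 6 + pi\<^sup>2 / 6"
    using assms by (intro add_mono half) (auto simp: inj_on_def)
  finally show ?thesis by simp
qed

text \<open>Serves in both directions: from \<open>p\<close> to its limit for the input sequence,
  and from the limit to \<open>q\<close> for the output.\<close>

lemma sum_powr_compare_exponents:
  fixes a s t :: "int \<Rightarrow> real" and C B :: real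
  assumes "\<And>k. 0 \<le> a k" "\<And>k. a k \<le> 1" "\<And>k. 1 \<le> s k"
    and st: "\<And>k. \<bar>s k - t k\<bar> \<le> C / ln (exp 1 + \<bar>real_of_int k\<bar>)"
    and "finite F" and B: "(\<Sum>k\<in>F. a k powr t k) \<le> B"
  shows "(\<Sum>k\<in>F. a k powr s k) \<le> exp (2 * C) * B + pi\<^sup>2 / 3"
proof -
  have "(\<Sum>k\<in>F. a k powr s k)
      \<le> (\<Sum>k\<in>F. exp (2 * C) * a k powr t k + 1 / (exp 1 + \<bar>real_of_int k\<bar>)\<^sup>2)"
  proof (rule sum_mono)
    fix k
    have "1 < exp 1 + \<bar>real_of_int k\<bar>"
      using exp_ge_add_one_self[of 1] by linarith
    then show "a k powr s k \<le> exp (2 * C) * a k powr t k + 1 / (exp 1 + \<bar>real_of_int k\<bar>)\<^sup>2"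
      using assms by (intro powr_compare_exponents) auto
  qed
  also have "\<dots> \<le> exp (2 * C) * B + pi\<^sup>2 / 3"
    unfolding sum.distrib sum_distrib_left[symmetric]
    using assms by (intro add_mono mult_left_mono sum_inverse_squares_int_le) auto
  finally show ?thesis .
qed

lemma modular_le_iff:
  assumes "0 \<le> B"
  shows "modular p a \<le> ennreal B \<longleftrightarrow> (\<forall>F. finite F \<longrightarrow> (\<Sum>k\<in>F. \<bar>a k\<bar> powr p k) \<le> B)"
  unfolding modular_def
  by (subst nonneg_infsum_complete) (auto simp: SUP_le_iff assms sum_nonneg)

text \<open>The logarithmic bound tends to 0, so \<open>P\<close> is the limit of \<open>p\<close>
  along the naturals and inherits its uniform bounds.\<close>

lemma LH_limit_bounds:
  assumes LH: "\<And>n. \<bar>p n - P\<bar> \<le> C / ln (exp 1 + \<bar>real_of_int n\<bar>)"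
  shows "\<And>c. (\<And>n. c \<le> p n) \<Longrightarrow> c \<le> P" and "\<And>c. (\<And>n. p n \<le> c) \<Longrightarrow> P \<le> c"
proof -
  have "filterlim (\<lambda>n. exp 1 + real n) at_top sequentially"
    by (intro filterlim_tendsto_add_at_top[OF tendsto_const] filterlim_real_sequentially)
  then have "(\<lambda>n. C / ln (exp 1 + real n)) \<longlonglongrightarrow> 0"
    by (intro tendsto_divide_0[OF tendsto_const] filterlim_at_top_imp_at_infinity
        filterlim_compose[OF ln_at_top])
  then have "(\<lambda>n. p (int n) - P) \<longlonglongrightarrow> 0"
    by (rule Lim_null_comparison[rotated]) (use LH[of "int _"] in auto)
  then have "(\<lambda>n. p (int n)) \<longlonglongrightarrow> P"
    by (simp add: LIM_zero_iff)
  then show "\<And>c. (\<And>n. c \<le> p n) \<Longrightarrow> c \<le> P" "\<And>c. (\<And>n. p n \<le> c) \<Longrightarrow> P \<le> c"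
    by (auto intro: LIMSEQ_le_const LIMSEQ_le_const2)
qed

section \<open>Uniform estimates on the unit ball\<close>

lemma frac_means_modular_bound:
  fixes \<alpha> P Q C C' :: real and p q :: "int \<Rightarrow> real"
  assumes "0 \<le> \<alpha>" "1 < P" "0 < Q" and PQ: "1 / P - 1 / Q = \<alpha>"
    and p: "\<And>n. 0 < p n" and q: "\<And>n. 1 \<le> q n"
    and LHp: "\<And>n. \<bar>p n - P\<bar> \<le> C / ln (exp 1 + \<bar>real_of_int n\<bar>)"
    and LHq: "\<And>n. \<bar>q n - Q\<bar> \<le> C' / ln (exp 1 + \<bar>real_of_int n\<bar>)"
  shows "\<exists>K>0. \<forall>b W i j. (\<forall>k. 0 \<le> b k) \<longrightarrow> modular p b \<le> 1 \<longrightarrow> finite W \<longrightarrow>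
           (\<forall>n. i n \<le> n \<and> n \<le> j n) \<longrightarrow>
           (\<Sum>n\<in>W. (real (card {i n..j n}) powr (\<alpha> - 1) * sum b {i n..j n} / K) powr q n) \<le> 1"
proof -
  \<comment> \<open>\<open>A\<close> bounds the sums of \<open>b k powr P\<close>, and
    \<open>B\<close> those of the \<open>Q\<close>-th powers of the fractional means. Division by
    \<open>L\<close> normalises the latter to 1, and \<open>E\<close> bounds the sums after
    \<open>Q\<close> is exchanged for \<open>q\<close>. The added 1 makes \<open>B\<close> and
    \<open>E\<close> at least 1.\<close>
  define A where "A = exp (2 * C) + pi\<^sup>2 / 3"
  define B where "B = frac_const \<alpha> P Q A + 1"
  define L where "L = B powr (1 / Q)"
  define E where "E = exp (2 * C') + pi\<^sup>2 / 3 + 1"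
  have A: "0 \<le> A" by (simp add: A_def)
  have B: "1 \<le> B"
    using A by (simp add: B_def frac_const_def maximal_const_nonneg)
  then have L: "0 < L" by (simp add: L_def)
  have E: "1 \<le> E" by (simp add: E_def)
  have "(\<Sum>n\<in>W. (real (card {i n..j n}) powr (\<alpha> - 1) * sum b {i n..j n} / (L * E)) powr q n) \<le> 1"
    if b: "\<And>k. 0 \<le> b k" and rho: "modular p b \<le> 1" and W: "finite W"
      and ij: "\<And>n. i n \<le> n \<and> n \<le> j n" for b W and i j :: "int \<Rightarrow> int"
  proof -
    define v where "v n = real (card {i n..j n}) powr (\<alpha> - 1) * sum b {i n..j n}" for n
    have v: "0 \<le> v n" for n by (simp add: v_def sum_nonneg b)
    have rho': "(\<Sum>k\<in>F. b k powr p k) \<le> 1" if "finite F" for F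
      using rho that b modular_le_iff[of 1 p b] by simp
    have b1: "b k \<le> 1" for k
    proof (rule ccontr)
      assume "\<not> b k \<le> 1"
      then have "1 < b k powr p k" using p[of k] by (intro gr_one_powr) auto
      then show False using rho'[of "{k}"] by simp
    qed
    have "(\<Sum>k\<in>F. b k powr P) \<le> A" if F: "finite F" for F
      using sum_powr_compare_exponents[where s = "\<lambda>_. P" and t = p and C = C, OF b b1 _ _ F rho'[OF F]]
        LHp \<open>1 < P\<close> by (simp add: A_def abs_minus_commute)
    then have "(\<Sum>n\<in>F. v n powr Q) \<le> frac_const \<alpha> P Q A" if "finite F" for F
      unfolding v_def using assms(1-4) b that ij by (intro frac_means_strong_type)
    then have vQ: "(\<Sum>n\<in>F. v n powr Q) \<le> B" if "finite F" for F
      using that by (fastforce simp: B_def)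
    have norm: "(\<Sum>n\<in>F. (v n / L) powr Q) \<le> 1" if "finite F" for F
    proof -
      have "(v n / L) powr Q = v n powr Q / B" for n
        using v[of n] L B \<open>0 < Q\<close> by (simp add: powr_divide L_def powr_powr)
      then show ?thesis
        using vQ[OF that] B by (simp add: flip: sum_divide_distrib)
    qed
    \<comment> \<open>Exchanging \<open>Q\<close> for \<open>q n\<close> requires values in the unit
      interval, which is why the division by \<open>L\<close> comes first.\<close>
    have v1: "v n / L \<le> 1" for n
    proof (rule ccontr)
      assume "\<not> v n / L \<le> 1"
      then have "1 < (v n / L) powr Q" using \<open>0 < Q\<close> by (intro gr_one_powr) auto
      then show False using norm[of "{n}"] by simp
    qed
    have "(\<Sum>n\<in>W. (v n / L) powr q n) \<le> exp (2 * C') * 1 + pi\<^sup>2 / 3"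
      using v L v1 q LHq W norm[OF W] by (intro sum_powr_compare_exponents[where t = "\<lambda>_. Q"]) auto
    then have E_bound: "(\<Sum>n\<in>W. (v n / L) powr q n) \<le> E" by (simp add: E_def)
    \<comment> \<open>Since \<open>E\<close> and \<open>q n\<close> are at least 1, dividing inside
      the power gains at least the factor \<open>E\<close>.\<close>
    have "(\<Sum>n\<in>W. (v n / (L * E)) powr q n) \<le> (\<Sum>n\<in>W. (v n / L) powr q n / E)"
    proof (rule sum_mono)
      fix n
      have "(v n / (L * E)) powr q n = (v n / L) powr q n / E powr q n"
        using v[of n] L E by (simp add: powr_divide flip: divide_divide_eq_left)
      also have "\<dots> \<le> (v n / L) powr q n / E"
        using E q[of n] powr_mono[of 1 "q n" E] by (intro divide_left_mono) auto
      finally show "(v n / (L * E)) powr q n \<le> (v n / L) powr q n / E" .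
    qed
    also have "\<dots> \<le> 1"
      using E_bound E by (simp flip: sum_divide_distrib)
    finally show ?thesis by (simp add: v_def)
  qed
  then show ?thesis using L E by (intro exI[of _ "L * E"]) auto
qed

lemma frac_maximal_alt:
  assumes "\<And>k. 0 \<le> a k"
  shows "frac_maximal \<alpha> a n = (SUP (i, j) \<in> {(i, j). i \<le> n \<and> n \<le> j}.
           ennreal (real (card {i..j}) powr (\<alpha> - 1) * sum a {i..j}))"
proof -
  have "{I. n \<in> I \<and> (\<exists>i j. I = {i..j})} = (\<lambda>(i, j). {i..j}) ` {(i, j). i \<le> n \<and> n \<le> j}"
    by force
  then show ?thesis
    unfolding frac_maximal_def by (simp add: image_image case_prod_unfold assms)
qed

lemma frac_maximal_scale:
  assumes "\<And>k. 0 \<le> b k" "0 \<le> l"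
  shows "frac_maximal \<alpha> (\<lambda>k. l * b k) n = ennreal l * frac_maximal \<alpha> b n"
  using assms
  by (simp add: frac_maximal_alt SUP_mult_left_ennreal case_prod_unfold ennreal_mult'[symmetric]
      sum_nonneg mult.left_commute flip: sum_distrib_left)

text \<open>Around each point an interval is chosen that reaches at least half of the supremum. The
  bound on finite sums is uniform in this choice, so it passes to the maximal function with
  \<open>K\<close> doubled.\<close>

lemma frac_maximal_unit_ball:
  fixes \<alpha> P Q C C' :: real and p q :: "int \<Rightarrow> real"
  assumes "0 \<le> \<alpha>" "1 < P" "0 < Q" "1 / P - 1 / Q = \<alpha>"
    and "\<And>n. 0 < p n" and q: "\<And>n. 1 \<le> q n"
    and "\<And>n. \<bar>p n - P\<bar> \<le> C / ln (exp 1 + \<bar>real_of_int n\<bar>)"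
    and "\<And>n. \<bar>q n - Q\<bar> \<le> C' / ln (exp 1 + \<bar>real_of_int n\<bar>)"
  shows "\<exists>K>0. \<forall>b. (\<forall>k. 0 \<le> b k) \<longrightarrow> modular p b \<le> 1 \<longrightarrow>
           (\<forall>n. frac_maximal \<alpha> b n < \<infinity>) \<and>
           modular q (\<lambda>n. enn2real (frac_maximal \<alpha> b n) / K) \<le> 1"
proof -
  obtain K where K: "0 < K" and "\<forall>b W i j. (\<forall>k. 0 \<le> b k) \<longrightarrow> modular p b \<le> 1 \<longrightarrow>
           finite W \<longrightarrow> (\<forall>n. i n \<le> n \<and> n \<le> j n) \<longrightarrow>
           (\<Sum>n\<in>W. (real (card {i n..j n}) powr (\<alpha> - 1) * sum b {i n..j n} / K) powr q n) \<le> 1"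
    using frac_means_modular_bound[OF assms] by (elim exE conjE)
  note means = this(2)[rule_format]
  have "(\<forall>n. frac_maximal \<alpha> b n < \<infinity>) \<and> modular q (\<lambda>n. enn2real (frac_maximal \<alpha> b n) / (2 * K)) \<le> 1"
    if b: "\<And>k. 0 \<le> b k" and rho: "modular p b \<le> 1" for b
  proof -
    define v where "v i j = real (card {i..j}) powr (\<alpha> - 1) * sum b {i..j}" for i j :: int
    have v: "0 \<le> v i j" for i j by (simp add: v_def sum_nonneg b)
    have M: "frac_maximal \<alpha> b n = (SUP (i, j) \<in> {(i, j). i \<le> n \<and> n \<le> j}. ennreal (v i j))" for n
      unfolding v_def by (rule frac_maximal_alt[OF b])
    have vK: "v i j \<le> K" if "i \<le> n" "n \<le> j" for i j n
    proof (rule ccontr)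
      assume "\<not> v i j \<le> K"
      then have "1 < (v i j / K) powr q n" using K q[of n] by (intro gr_one_powr) auto
      \<comment> \<open>\<open>means\<close> asks for an interval around every integer;
        \<open>min\<close> and \<open>max\<close> supply one and leave \<open>{i..j}\<close>
        unchanged at the point in question.\<close>
      moreover have "(\<Sum>n\<in>{n}. (v (min i n) (max j n) / K) powr q n) \<le> 1"
        unfolding v_def by (rule means[where b = b]) (use b rho in auto)
      ultimately show False using that by simp
    qed
    have le: "frac_maximal \<alpha> b n \<le> ennreal K" for n
      unfolding M using vK by (intro SUP_least) (auto intro: ennreal_leI)
    have fin: "frac_maximal \<alpha> b n < \<infinity>" for n
      by (rule le_less_trans[OF le]) simp
    define m where "m n = enn2real (frac_maximal \<alpha> b n)" for n
    have m: "frac_maximal \<alpha> b n = ennreal (m n)" "0 \<le> m n" for n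
      using fin[of n] by (simp_all add: m_def)
    \<comment> \<open>Half of a positive finite supremum lies strictly below it and is therefore
      exceeded by some interval; when the supremum is 0, the singleton of \<open>n\<close> will
      do.\<close>
    have "\<exists>i j. i \<le> n \<and> n \<le> j \<and> m n \<le> 2 * v i j" for n
    proof (cases "m n = 0")
      case True
      then show ?thesis using v[of n n] by (intro exI[of _ n]) simp
    next
      case False
      then have "ennreal (m n / 2) < ennreal (m n)"
        using m(2)[of n] by (intro ennreal_lessI) auto
      then have "ennreal (m n / 2) < (SUP (i, j) \<in> {(i, j). i \<le> n \<and> n \<le> j}. ennreal (v i j))"
        unfolding m(1)[symmetric] M .
      then obtain i j where "i \<le> n" "n \<le> j" "ennreal (m n / 2) < ennreal (v i j)"
        by (auto simp: less_SUP_iff)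
      then show ?thesis using m(2)[of n] by (intro exI[of _ i] exI[of _ j]) (auto simp: ennreal_less_iff)
    qed
    then obtain i j where ij: "\<And>n. i n \<le> n \<and> n \<le> j n" and m_le: "\<And>n. m n \<le> 2 * v (i n) (j n)"
      by metis
    have "(\<Sum>n\<in>W. \<bar>m n / (2 * K)\<bar> powr q n) \<le> 1" if "finite W" for W
    proof -
      have "(\<Sum>n\<in>W. \<bar>m n / (2 * K)\<bar> powr q n) \<le> (\<Sum>n\<in>W. (v (i n) (j n) / K) powr q n)"
      proof (rule sum_mono)
        fix n
        have "m n / (2 * K) \<le> v (i n) (j n) / K"
          using m_le[of n] K by (simp add: field_simps)
        then show "\<bar>m n / (2 * K)\<bar> powr q n \<le> (v (i n) (j n) / K) powr q n"
          using m(2)[of n] K q[of n] by (intro powr_mono2) auto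
      qed
      also have "\<dots> \<le> 1"
        unfolding v_def by (rule means[where b = b, OF b rho that ij])
      finally show ?thesis .
    qed
    then have "modular q (\<lambda>n. m n / (2 * K)) \<le> 1"
      using modular_le_iff[of 1 q "\<lambda>n. m n / (2 * K)"] by simp
    then show ?thesis using fin by (simp add: m_def)
  qed
  then show ?thesis using K by (intro exI[of _ "2 * K"]) auto
qed

section \<open>From modulars to norms\<close>

lemma modular_divide_le:
  assumes "\<And>k. 1 \<le> p k" "1 \<le> c" "0 \<le> B" "modular p a \<le> ennreal B"
  shows "modular p (\<lambda>k. a k / c) \<le> ennreal (B / c)"
proof -
  have "(\<Sum>k\<in>F. \<bar>a k / c\<bar> powr p k) \<le> B / c" if "finite F" for F
  proof -
    have "(\<Sum>k\<in>F. \<bar>a k / c\<bar> powr p k) \<le> (\<Sum>k\<in>F. \<bar>a k\<bar> powr p k / c)"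
    proof (rule sum_mono)
      fix k
      have "\<bar>a k / c\<bar> powr p k = \<bar>a k\<bar> powr p k / c powr p k"
        using assms(2) by (simp add: powr_divide)
      also have "\<dots> \<le> \<bar>a k\<bar> powr p k / c"
        using assms(2) powr_mono[of 1 "p k" c] assms(1)[of k] by (intro divide_left_mono) auto
      finally show "\<bar>a k / c\<bar> powr p k \<le> \<bar>a k\<bar> powr p k / c" .
    qed
    also have "\<dots> \<le> B / c"
      using assms that by (simp add: modular_le_iff divide_right_mono flip: sum_divide_distrib)
    finally show ?thesis .
  qed
  then show ?thesis using assms by (subst modular_le_iff) auto
qed

text \<open>If the modular has the finite value \<open>B\<close>, dividing further by
  \<open>B + 1\<close> brings it below 1. Thus the infimum defining the norm ranges over a nonempty
  set.\<close>

lemma lpvar_unit_modular: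
  assumes "\<And>k. 1 \<le> p k" "a \<in> lpvar p"
  obtains l where "0 < l" "modular p (\<lambda>k. a k / l) \<le> 1"
proof -
  obtain l where l: "0 < l" and fin: "modular p (\<lambda>k. a k / l) < \<infinity>"
    using assms(2) by (auto simp: lpvar_def)
  define B where "B = enn2real (modular p (\<lambda>k. a k / l))"
  have B: "0 \<le> B" "modular p (\<lambda>k. a k / l) = ennreal B"
    using fin by (simp_all add: B_def)
  have "modular p (\<lambda>k. a k / l / (B + 1)) \<le> ennreal (B / (B + 1))"
    using assms(1) B by (intro modular_divide_le) auto
  also have "\<dots> \<le> 1"
    using B(1) by simp
  finally show thesis
    using l B(1) by (intro that[of "l * (B + 1)"]) auto
qed

lemma lpvar_norm_le:
  assumes "0 < l" "modular p (\<lambda>k. a k / l) \<le> 1"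
  shows "lpvar_norm p a \<le> l"
  unfolding lpvar_norm_def using assms by (intro cInf_lower bdd_belowI[of _ 0]) auto

theorem theorem5p1:
  fixes \<alpha> :: real and p q :: "int \<Rightarrow> real"
  assumes "0 \<le> \<alpha>" and "\<alpha> < 1"
    and "p \<in> exponent_seqs"
    and "1 < exp_minus p"
    and "\<alpha> \<noteq> 0 \<longrightarrow> exp_plus p < 1 / \<alpha>"
    and "\<And>k. 1 / p k - 1 / q k = \<alpha>"
    and "p \<in> LH_inf" and "q \<in> LH_inf"
  shows "\<exists>C>0. \<forall>a \<in> lpvar p. (\<forall>i. 0 \<le> a i) \<longrightarrow>
           (\<forall>n. frac_maximal \<alpha> a n < \<infinity>) \<and>
           (\<lambda>n. enn2real (frac_maximal \<alpha> a n)) \<in> lpvar q \<and>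
           lpvar_norm q (\<lambda>n. enn2real (frac_maximal \<alpha> a n)) \<le> C * lpvar_norm p a"
proof -
  have bdd: "bounded (range p)" and p1: "\<And>n. 1 \<le> p n"
    using assms(3) by (auto simp: exponent_seqs_def)
  have p_minus: "exp_minus p \<le> p n" and p_plus: "p n \<le> exp_plus p" for n
    using bounded_imp_bdd_below[OF bdd] bounded_imp_bdd_above[OF bdd]
    by (auto simp: exp_minus_def exp_plus_def intro: cINF_lower cSUP_upper)
  \<comment> \<open>A common positive lower bound for all \<open>1 / q n\<close> and for
    \<open>1 / Q\<close>; it keeps these exponents below \<open>1 / \<delta>\<close>.\<close>
  define \<delta> where "\<delta> = 1 / exp_plus p - \<alpha>"
  have plus: "0 < exp_plus p" using p1[of 0] p_plus[of 0] by linarith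
  have \<delta>: "0 < \<delta>"
    using assms(1,5) plus by (cases "\<alpha> = 0") (auto simp: \<delta>_def field_simps)
  obtain C P where "0 < C" and LHp: "\<And>n. \<bar>p n - P\<bar> \<le> C / ln (exp 1 + \<bar>real_of_int n\<bar>)"
    using assms(7) by (auto simp: LH_inf_def)
  have P: "1 < P" "P \<le> exp_plus p"
    using LH_limit_bounds[OF LHp] p_minus p_plus assms(4) less_le_trans by blast+
  define Q where "Q = 1 / (1 / P - \<alpha>)"
  have conjugate: "1 \<le> s' \<and> s' \<le> 1 / \<delta>" if "1 / s - 1 / s' = \<alpha>" "1 \<le> s" "s \<le> exp_plus p" for s s'
  proof -
    have "1 / exp_plus p \<le> 1 / s" "1 / s \<le> 1"
      using that plus by (auto intro: divide_left_mono)
    then have "\<delta> \<le> 1 / s'" "1 / s' \<le> 1"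
      using that(1) assms(1) unfolding \<delta>_def by linarith+
    \<comment> \<open>This rules out negative \<open>s'\<close> and also \<open>s' = 0\<close>,
      where \<open>1 / s'\<close> is 0 by convention.\<close>
    moreover have "0 < s'" using \<open>\<delta> \<le> 1 / s'\<close> \<delta> by (metis less_le_trans zero_less_divide_1_iff)
    ultimately show ?thesis using \<delta> by (simp add: field_simps)
  qed
  have PQ: "1 / P - 1 / Q = \<alpha>" by (simp add: Q_def)
  have q: "1 \<le> q n" "q n \<le> 1 / \<delta>" for n
    using conjugate[OF assms(6) p1 p_plus] by auto
  have Q: "1 \<le> Q" "Q \<le> 1 / \<delta>"
    using conjugate[OF PQ] P by auto
  \<comment> \<open>The reciprocals of \<open>p\<close> and \<open>q\<close> differ by a constant,
    so their deviations from the limits agree. Clearing denominators costs at most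
    \<open>1 / \<delta>\<^sup>2\<close>. The centre must be this \<open>Q\<close>, tied to
    \<open>P\<close> by \<open>PQ\<close>.\<close>
  have LHq: "\<bar>q n - Q\<bar> \<le> (C / \<delta>\<^sup>2) / ln (exp 1 + \<bar>real_of_int n\<bar>)" for n
  proof -
    have "1 / Q - 1 / q n = 1 / P - 1 / p n"
      using PQ assms(6)[of n] by linarith
    moreover have "1 / Q - 1 / q n = (q n - Q) / (q n * Q)"
      using q(1)[of n] Q(1) by (simp add: diff_frac_eq)
    moreover have "1 / P - 1 / p n = (p n - P) / (p n * P)"
      using p1[of n] P(1) by (simp add: diff_frac_eq)
    ultimately have "q n - Q = (p n - P) / (p n * P) * (q n * Q)"
      using q(1)[of n] Q(1) by (simp add: nonzero_divide_eq_eq)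
    then have "\<bar>q n - Q\<bar> = \<bar>p n - P\<bar> / (p n * P) * (q n * Q)"
      using q(1)[of n] Q(1) p1[of n] P(1) by (simp add: abs_mult)
    also have "\<dots> \<le> \<bar>p n - P\<bar> / 1 * (1 / \<delta> * (1 / \<delta>))"
      using q[of n] Q p1[of n] P(1) \<delta> mult_mono[of 1 "p n" 1 P]
      by (intro mult_mono divide_left_mono) auto
    also have "\<dots> \<le> (C / ln (exp 1 + \<bar>real_of_int n\<bar>)) / 1 * (1 / \<delta> * (1 / \<delta>))"
      using LHp[of n] \<delta> by (intro mult_right_mono) auto
    finally show ?thesis by (simp add: power2_eq_square mult.commute)
  qed
  obtain K where K: "0 < K" and unit_ball: "\<And>b. (\<And>k. 0 \<le> b k) \<Longrightarrow> modular p b \<le> 1 \<Longrightarrow>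
           (\<forall>n. frac_maximal \<alpha> b n < \<infinity>) \<and>
           modular q (\<lambda>n. enn2real (frac_maximal \<alpha> b n) / K) \<le> 1"
    using frac_maximal_unit_ball[OF assms(1) P(1) _ PQ _ q(1) LHp LHq] Q(1) p1
    by (metis less_le_trans zero_less_one)
  show ?thesis
  proof (intro exI[of _ K] conjI ballI allI impI K)
    fix a assume a: "a \<in> lpvar p" and nonneg: "\<forall>i. 0 \<le> a i"
    let ?M = "\<lambda>n. enn2real (frac_maximal \<alpha> a n)"
    \<comment> \<open>By homogeneity, each \<open>l\<close> admissible for \<open>a\<close> makes
      \<open>l * K\<close> admissible for the maximal function.\<close>
    have scaled: "(\<forall>n. frac_maximal \<alpha> a n < \<infinity>) \<and> modular q (\<lambda>n. ?M n / (l * K)) \<le> 1"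
      if l: "0 < l" "modular p (\<lambda>k. a k / l) \<le> 1" for l
    proof -
      let ?b = "\<lambda>k. a k / l"
      have b: "0 \<le> ?b k" for k using nonneg l(1) by simp
      have "frac_maximal \<alpha> a n = ennreal l * frac_maximal \<alpha> ?b n" for n
        using frac_maximal_scale[of ?b l \<alpha> n] b l(1) by simp
      then show ?thesis
        using unit_ball[OF b l(2)] l(1) by (auto simp: ennreal_mult_less_top enn2real_mult)
    qed
    obtain l where l: "0 < l" "modular p (\<lambda>k. a k / l) \<le> 1"
      using lpvar_unit_modular[OF p1 a] .
    show "frac_maximal \<alpha> a n < \<infinity>" for n using scaled[OF l] by blast
    have "modular q (\<lambda>n. ?M n / (l * K)) < \<infinity>"
      by (rule le_less_trans[OF conjunct2[OF scaled[OF l]]]) simp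
    then show "?M \<in> lpvar q"
      unfolding lpvar_def mem_Collect_eq by (intro exI[of _ "l * K"] conjI mult_pos_pos l(1) K)
    \<comment> \<open>Comparing with every admissible \<open>l\<close> avoids the question whether
      the infimum is attained.\<close>
    have "lpvar_norm q ?M / K \<le> lpvar_norm p a"
      unfolding lpvar_norm_def[of p]
    proof (rule cInf_greatest)
      show "{l. 0 < l \<and> modular p (\<lambda>k. a k / l) \<le> 1} \<noteq> {}" using l by blast
      fix l assume "l \<in> {l. 0 < l \<and> modular p (\<lambda>k. a k / l) \<le> 1}"
      then have "lpvar_norm q ?M \<le> l * K"
        using scaled K by (intro lpvar_norm_le) auto
      then show "lpvar_norm q ?M / K \<le> l" using K by (simp add: divide_le_eq)
    qed
    then show "lpvar_norm q ?M \<le> K * lpvar_norm p a"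
      using K by (simp add: divide_le_eq mult.commute)
  qed
qed

end
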